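(* Let $H_1\cong H_2\cong(\mathbb{C}^2)^{\otimes n}$, let $\rho$ be a density matrix on $H_1$, let $\mathcal{E}:\mathcal{B}(H_1)\to\mathcal{B}(H_2)$ be a completely positive trace-preserving map with Choi–Jamiołkowski matrix $M$, and let $$R=\mathcal{R}_\rho(M):=\tfrac12\big((\rho\otimes\mathbb{1}_2)M+M(\rho\otimes\mathbb{1}_2)\big)\in\mathcal{B}(H_1\otimes H_2).$$ Put $\tilde\rho=\rho\otimes\mathbb{1}_2$ and $A=\frac12\big(\tilde\rho\otimes\mathbb{1}+\mathbb{1}\otimes\tilde\rho^{T}\big)$, acting on $(H_1\otimes H_2)\otimes(H_1\otimes H_2)$, where $\mathbb{1}$ is the identity on $H_1\otimes H_2$. Then $|R\rangle\!\rangle=A|M\rangle\!\rangle$, and the following hold. (1) If $\rho$ is full rank, then $A$ and the linear map $\mathcal{R}_\rho:\mathcal{B}(H_1\otimes H_2)\to\mathcal{B}(H_1\otimes H_2)$ are invertible, $|M\rangle\!\rangle=A^{-1}|R\rangle\!\rangle$, and $$M=2\int_0^\infty e^{-t\tilde\rho}\,R\,e^{-t\tilde\rho}\,dt .$$ (2) If $\rho$ is rank deficient, then $A$ is rank deficient and $\mathcal{R}_\rho$ is not invertible; with $A^{\ddagger}$ the Moore–Penrose pseudoinverse of $A$, the operator $P=A^{\ddagger}A$ is the orthogonal projector onto $\mathrm{Supp}(A)=\mathrm{Ker}(A)^\perp$, and $A^{\ddagger}|R\rangle\!\rangle=P|M\rangle\!\rangle$.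
   Context: The Choi–Jamiołkowski matrix of $\mathcal{E}$ is $M=\sum_{i,j=0}^{2^n-1}|i\rangle\langle j|\otimes\mathcal{E}(|j\rangle\langle i|)\in\mathcal{B}(H_1\otimes H_2)$. The operator $R$ is the (closed form of the) two-time pseudo-density matrix of the process with initial state $\rho$ and channel $\mathcal{E}$. The formula for $\mathcal{R}_\rho$ defines a linear map on all of $\mathcal{B}(H_1\otimes H_2)$. The vectorization of an operator $O=\sum_{ij}O_{ij}|i\rangle\langle j|\in\mathcal{B}(H)$ is $|O\rangle\!\rangle=\sum_{ij}O_{ij}|i\rangle\otimes|j\rangle\in H\otimes H$, in the computational basis; $T$ is the transpose in that basis. *)

theory Defs
  imports "HOL-Analysis.Analysis"
begin

text \<open>
  Operators are identified with their matrices in the computational basis: a space whose basis is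
  labelled by a finite type \<open>'a\<close> is \<open>complex^'a\<close>, its operators are \<open>complex^'a^'a\<close> with
  \<open>X $ i $ j\<close> the coefficient of \<open>|i><j|\<close>, and the basis of a tensor product is labelled by the
  product type.
\<close>

definition cinner :: "complex^'a \<Rightarrow> complex^'a \<Rightarrow> complex" where
  "cinner u v = (\<Sum>i\<in>UNIV. cnj (u $ i) * v $ i)"

definition dagger :: "complex^'m^'n \<Rightarrow> complex^'n^'m" where
  "dagger X = (\<chi> i j. cnj (X $ j $ i))"

text \<open>
  The library's \<open>linear\<close> on \<open>complex^'a^'a\<close> is linearity over the reals, and \<open>(*s)\<close> does not scale a
  matrix by a complex number, hence the explicit scalar multiplication.
\<close>

definition cscale :: "complex \<Rightarrow> complex^'m^'n \<Rightarrow> complex^'m^'n" where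
  "cscale c X = (\<chi> i j. c * X $ i $ j)"

abbreviation clinear :: "(complex^'m^'n \<Rightarrow> complex^'k^'l) \<Rightarrow> bool" where
  "clinear \<equiv> Vector_Spaces.linear cscale cscale"

definition kron :: "complex^'m^'n \<Rightarrow> complex^'k^'l \<Rightarrow> complex^('m \<times> 'k)^('n \<times> 'l)"
  (infixr "\<otimes>" 75) where
  "X \<otimes> Y = (\<chi> p q. X $ fst p $ fst q * Y $ snd p $ snd q)"

definition ketbra :: "'a \<Rightarrow> 'a \<Rightarrow> complex^'a^'a" where
  "ketbra i j = (\<chi> k l. if k = i \<and> l = j then 1 else 0)"

definition vectorization :: "complex^'a^'a \<Rightarrow> complex^('a \<times> 'a)" where
  "vectorization X = (\<chi> p. X $ fst p $ snd p)"

text \<open>Over the complex numbers the condition on the quadratic form already makes \<open>X\<close> Hermitian.\<close>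

definition psd :: "complex^'a^'a \<Rightarrow> bool" where
  "psd X \<longleftrightarrow> (\<forall>v. cinner v (X *v v) \<in> \<real>\<^sub>\<ge>\<^sub>0)"

definition density_matrix :: "complex^'a^'a \<Rightarrow> bool" where
  "density_matrix \<rho> \<longleftrightarrow> psd \<rho> \<and> trace \<rho> = 1"

text \<open>
  An operator on the tensor product of a \<open>k\<close>-dimensional ancilla with \<open>complex^'a\<close> is a
  \<open>k \<times> k\<close> block matrix \<open>X p q\<close> (\<open>p, q < k\<close>) of operators on \<open>complex^'a\<close>, a vector is a family
  \<open>v p\<close> (\<open>p < k\<close>), and the tensor product of the identity with a map \<open>\<E>\<close> applies \<open>\<E>\<close> to every
  block. The ancilla is indexed by naturals because its dimension is quantified over in the
  definition of complete positivity.
\<close>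

definition psd_block :: "nat \<Rightarrow> (nat \<Rightarrow> nat \<Rightarrow> complex^'a^'a) \<Rightarrow> bool" where
  "psd_block k X \<longleftrightarrow>
     (\<forall>v. (\<Sum>p<k. \<Sum>q<k. cinner (v p) (X p q *v v q)) \<in> \<real>\<^sub>\<ge>\<^sub>0)"

definition completely_positive :: "(complex^'a^'a \<Rightarrow> complex^'b^'b) \<Rightarrow> bool" where
  "completely_positive \<E> \<longleftrightarrow>
     clinear \<E> \<and> (\<forall>k X. psd_block k X \<longrightarrow> psd_block k (\<lambda>p q. \<E> (X p q)))"

definition trace_preserving :: "(complex^'a^'a \<Rightarrow> complex^'b^'b) \<Rightarrow> bool" where
  "trace_preserving \<E> \<longleftrightarrow> (\<forall>X. trace (\<E> X) = trace X)"

definition choi :: "(complex^'a^'a \<Rightarrow> complex^'b^'b) \<Rightarrow> complex^('a \<times> 'b)^('a \<times> 'b)" where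
  "choi \<E> = (\<Sum>i\<in>UNIV. \<Sum>j\<in>UNIV. ketbra i j \<otimes> \<E> (ketbra j i))"

definition Rmap ::
  "complex^'a^'a \<Rightarrow> complex^('a \<times> 'b::finite)^('a \<times> 'b) \<Rightarrow> complex^('a \<times> 'b)^('a \<times> 'b)" where
  "Rmap \<rho> X = (1/2) *\<^sub>R ((\<rho> \<otimes> mat 1) ** X + X ** (\<rho> \<otimes> mat 1))"

text \<open>The library's \<open>exp\<close> is not available: \<open>vec\<close> carries no Banach algebra structure.\<close>

definition matpow :: "complex^'a^'a \<Rightarrow> nat \<Rightarrow> complex^'a^'a" where
  "matpow X k = (((**) X) ^^ k) (mat 1)"

definition mexp :: "complex^'a^'a \<Rightarrow> complex^'a^'a" where
  "mexp X = (\<Sum>k. (1 / fact k) *\<^sub>R matpow X k)"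

definition is_pinv :: "complex^'m^'n \<Rightarrow> complex^'n^'m \<Rightarrow> bool" where
  "is_pinv X Y \<longleftrightarrow> X ** Y ** X = X \<and> Y ** X ** Y = Y \<and>
     dagger (X ** Y) = X ** Y \<and> dagger (Y ** X) = Y ** X"

definition pinv :: "complex^'m^'n \<Rightarrow> complex^'n^'m" where
  "pinv X = (THE Y. is_pinv X Y)"

definition Ker :: "complex^'m^'n \<Rightarrow> (complex^'m) set" where
  "Ker X = {v. X *v v = 0}"

definition ocompl :: "(complex^'a) set \<Rightarrow> (complex^'a) set" where
  "ocompl S = {u. \<forall>v\<in>S. cinner v u = 0}"

definition Supp :: "complex^'m^'n \<Rightarrow> (complex^'m) set" where
  "Supp X = ocompl (Ker X)"

definition orthogonal_projector_onto :: "complex^'a^'a \<Rightarrow> (complex^'a) set \<Rightarrow> bool" where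
  "orthogonal_projector_onto P S \<longleftrightarrow> P ** P = P \<and> dagger P = P \<and> range ((*v) P) = S"

lemma vector_space_cscale: "vector_space (cscale :: complex \<Rightarrow> complex^'m^'n \<Rightarrow> _)"
  by unfold_locales (simp_all add: cscale_def vec_eq_iff algebra_simps)

lemma clinear_iff:
  "clinear f \<longleftrightarrow> (\<forall>X Y. f (X + Y) = f X + f Y) \<and> (\<forall>c X. f (cscale c X) = cscale c (f X))"
  by (auto simp: Vector_Spaces.linear_def module_hom_def module_hom_axioms_def
      vector_space_cscale module_iff_vector_space)

lemma clinear_Rmap: "clinear (Rmap \<rho>)"
  unfolding clinear_iff Rmap_def cscale_def matrix_matrix_mult_def
  by (simp add: vec_eq_iff sum.distrib sum_distrib_left algebra_simps scaleR_conv_of_real)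

end

theory Submission imports Defs begin

text \<open>
  Vectorization turns \<open>X \<mapsto> (\<rho>t X + X \<rho>t)/2\<close> into multiplication by \<open>A\<close>, so everything reduces
  to the anticommutator with \<open>B = \<rho> \<otimes> 1\<close>. If \<open>\<rho>\<close> has full rank, then \<open>B\<close> is positive definite, an energy
  estimate gives exponential decay of \<open>exp (-tB)\<close>, and integrating
  \<open>d/dt (exp (-tB) X exp (-tB)) = - exp (-tB) (BX + XB) exp (-tB)\<close> over the half-line recovers \<open>X\<close> from
  \<open>BX + XB\<close>. This is the integral formula, and it also shows that the anticommutator is injective, hence
  bijective. If \<open>\<rho>\<close> kills a vector \<open>u \<noteq> 0\<close>, then \<open>|v><v|\<close> with \<open>v = u \<otimes> (1,...,1)\<close> is annihilated by the
  anticommutator.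

  The pseudoinverse of a complex matrix exists because the normal equations \<open>A\<^sup>* A X = A\<^sup>*\<close> are solvable:
  with \<open>X\<close> and \<open>W\<close> solving them for \<open>A\<close> and \<open>A\<^sup>*\<close>, the pseudoinverse is \<open>W\<^sup>* A X\<close>.
\<close>

section \<open>Hermitian forms and positive matrices\<close>

lemma dagger_dagger [simp]: "dagger (dagger X) = X"
  by (simp add: dagger_def vec_eq_iff)

lemma dagger_mult: "dagger (X ** Y) = dagger Y ** dagger X"
  by (simp add: dagger_def vec_eq_iff matrix_matrix_mult_def mult.commute)

lemma matrix_diff_ldistrib: "A ** (B - C) = A ** B - A ** (C :: 'c::ring_1^'a^'b)"
  by (simp add: vec_eq_iff matrix_matrix_mult_def sum_subtractf algebra_simps)

lemma cinner_adjoint: "cinner u (X *v v) = cinner (dagger X *v u) v"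
  unfolding cinner_def dagger_def matrix_vector_mult_def
  by (simp add: sum_distrib_left sum_distrib_right algebra_simps) (rule sum.swap)

lemma cinner_right_add: "cinner u (v + w) = cinner u v + cinner u w"
  by (simp add: cinner_def algebra_simps sum.distrib)

lemma cinner_left_add: "cinner (u + v) w = cinner u w + cinner v w"
  by (simp add: cinner_def algebra_simps sum.distrib)

lemma cinner_right_diff: "cinner u (v - w) = cinner u v - cinner u w"
  by (simp add: cinner_def algebra_simps sum_subtractf)

lemma cinner_right_scale: "cinner u (c *s v) = c * cinner u v"
  by (simp add: cinner_def sum_distrib_left algebra_simps)

lemma cinner_left_scale: "cinner (c *s u) v = cnj c * cinner u v"
  by (simp add: cinner_def sum_distrib_left algebra_simps)

lemma cinner_commute: "cinner u v = cnj (cinner v u)"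
  by (simp add: cinner_def mult.commute)

lemma cinner_0_left [simp]: "cinner 0 u = 0"
  by (simp add: cinner_def)

lemma cinner_0_right [simp]: "cinner u 0 = 0"
  by (simp add: cinner_def)

lemma Re_cinner: "Re (cinner u v) = inner u v"
  by (simp add: cinner_def inner_vec_def inner_complex_def)

lemma cinner_self: "cinner v v = complex_of_real (inner v v)"
  by (rule complex_eqI) (simp_all add: Re_cinner, simp add: cinner_def)

lemma cinner_self_eq_0_iff [simp]: "cinner v v = 0 \<longleftrightarrow> v = 0"
  by (simp add: cinner_self)

lemma cinner_axis: "cinner (axis i 1) (X *v axis j 1) = X $ i $ j"
  by (simp add: cinner_def axis_def matrix_vector_mult_def if_distrib if_distribR sum.delta cong: if_cong)

text \<open>Polarization: testing on \<open>u + v\<close> gives the sum of the two cross terms, and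
  testing on \<open>u\<close> plus i times \<open>v\<close> gives their difference, so both
  vanish.\<close>

lemma matrix_eq_0_if_quadratic_form_0:
  assumes "\<And>v. cinner v (D *v v) = 0"
  shows "D = 0"
proof -
  have 0: "cinner u (D *v v) + cinner v (D *v u) = 0" for u v
    using assms[of "u + v"]
    by (simp add: assms cinner_left_add cinner_right_add matrix_vector_right_distrib add.commute)
  have "cinner u (D *v v) = 0" for u v
  proof -
    have "\<i> * cinner u (D *v v) - \<i> * cinner v (D *v u) = 0"
      using 0[of u "\<i> *s v"]
      by (simp add: cinner_left_scale cinner_right_scale vec.scale)
    then have "cinner u (D *v v) = cinner v (D *v u)" by simp
    with 0[of u v] show ?thesis by simp
  qed
  then have "D $ i $ j = 0" for i j
    by (metis cinner_axis)
  then show ?thesis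
    by (simp add: vec_eq_iff)
qed

text \<open>A quadratic form with real values agrees with that of the adjoint, so polarization
  applies to the difference.\<close>

lemma psd_hermitian:
  assumes "psd X"
  shows "dagger X = X"
proof -
  have "cinner v ((X - dagger X) *v v) = 0" for v
  proof -
    have "cinner v (dagger X *v v) = cnj (cinner v (X *v v))"
      by (metis cinner_adjoint cinner_commute dagger_dagger)
    also have "\<dots> = cinner v (X *v v)"
      using assms unfolding psd_def by (metis Reals_cnj_iff nonneg_Reals_subset_Reals subsetD)
    finally have "cinner v (X *v v) - cinner v (dagger X *v v) = 0" by simp
    then show ?thesis
      by (simp add: matrix_vector_mult_diff_rdistrib cinner_def sum_subtractf algebra_simps)
  qed
  then show ?thesis
    using matrix_eq_0_if_quadratic_form_0 by force
qed

lemma psd_inner_nonneg: "psd X \<Longrightarrow> 0 \<le> inner v (X *v v)"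
  by (metis Re_cinner complex_nonneg_Reals_iff psd_def)

lemma inner_adjoint: "inner u (X *v v) = inner (dagger X *v u) v"
  by (metis Re_cinner cinner_adjoint)

text \<open>The form attains its minimum 0 at \<open>v\<close>. If \<open>X *v v\<close> were
  nonzero, a small step from \<open>v\<close> in the direction of \<open>- (X *v v)\<close> would
  make the form negative.\<close>

lemma psd_kernel:
  assumes "psd X" and "inner v (X *v v) = 0"
  shows "X *v v = 0"
proof (rule ccontr)
  let ?w = "X *v v"
  define a c where "a = inner ?w ?w" and "c = inner ?w (X *v ?w)"
  assume "?w \<noteq> 0"
  then have a: "a > 0" by (simp add: a_def)
  have c: "c \<ge> 0" unfolding c_def using assms(1) by (rule psd_inner_nonneg)
  \<comment> \<open>The form at the shifted point is \<open>t * (t * c - 2 * a)\<close>. This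
    \<open>t\<close> keeps \<open>t * c\<close> below \<open>2 * a\<close>, and the
    \<open>+ 1\<close> covers \<open>c = 0\<close>.\<close>
  define t where "t = a / (c + 1)"
  have t: "t > 0" using a c by (simp add: t_def)
  have "inner v (X *v ?w) = a"
    by (simp add: a_def inner_adjoint psd_hermitian[OF assms(1)])
  then have "inner (v - t *\<^sub>R ?w) (X *v (v - t *\<^sub>R ?w)) = t * (t * c - 2 * a)"
    using assms(2)
    by (simp add: algebra_simps inner_diff_left inner_diff_right linear_scale[OF matrix_vector_mul_linear]
        a_def c_def power2_eq_square)
  then have "0 \<le> t * (t * c - 2 * a)"
    using psd_inner_nonneg[OF assms(1)] by metis
  with t have "2 * a \<le> t * c" by (simp add: zero_le_mult_iff)
  also have "t * c \<le> a" using a c by (simp add: t_def field_simps)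
  finally show False using a by simp
qed

section \<open>Rank and kernel\<close>

lemma rank_eq_card_iff_inj:
  fixes A :: "'c::field^'n^'m"
  shows "rank A = CARD('n) \<longleftrightarrow> inj ((*v) A)"
  \<comment> \<open>Through the row rank: full column rank says that the rows span, which is left
    invertibility and hence injectivity.\<close>
  by (simp add: row_rank_def_gen matrix_left_invertible_injective [symmetric]
      matrix_left_invertible_span_rows_gen vec.dim_eq_full [symmetric] vec.dimension_def card_cart_basis)

lemma rank_le_card:
  fixes A :: "'c::field^'n^'m"
  shows "rank A \<le> CARD('n)"
  using vec.dim_subset_UNIV[of "rows A"] by (simp add: row_rank_def_gen vec.dimension_def card_cart_basis)

lemma rank_less_card_iff_ker:
  fixes A :: "'c::field^'n^'m"
  shows "rank A < CARD('n) \<longleftrightarrow> (\<exists>v. v \<noteq> 0 \<and> A *v v = 0)"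
  using rank_le_card[of A] rank_eq_card_iff_inj[of A] vec.inj_iff_eq_0[of A]
  by (auto simp: less_le)

section \<open>The Moore--Penrose pseudoinverse\<close>

lemma mult_dagger_eq_0:
  assumes "dagger D ** D = 0"
  shows "D = (0 :: complex^'m^'n)"
proof -
  have "D *v v = 0" for v
    using assms cinner_adjoint[of "D *v v" D v]
    by (metis cinner_adjoint cinner_self_eq_0_iff dagger_dagger matrix_vector_mul_assoc
        matrix_vector_mult_0 cinner_0_right)
  then show ?thesis
    by (simp add: matrix_eq)
qed

text \<open>Here "inner" refers to generalized inverses: any linear right inverse of
  \<open>H\<close> on its range will do.\<close>

lemma inner_inverse_exists:
  fixes H :: "'c::field^'m^'n"
  obtains G where "H ** G ** H = H"
proof -
  obtain g where g: "Vector_Spaces.linear (*s) (*s) g" and "\<And>v. H *v (g (H *v v)) = H *v v"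
    using vec.linear_exists_right_inverse_on[OF matrix_vector_mul_linear_gen vec.subspace_UNIV, of H]
    by auto
  then have "H ** matrix g ** H = H"
    by (simp add: matrix_eq matrix_vector_mul_assoc [symmetric] matrix_works)
  then show ?thesis
    using that by blast
qed

text \<open>The defect \<open>D\<close> of \<open>A ** G ** ?H = A\<close> is killed by
  \<open>dagger A\<close> and also has \<open>A\<close> as a left factor, so
  \<open>dagger D ** D = 0\<close>. The adjoint of the resulting identity exhibits the solution
  \<open>dagger G ** dagger A\<close>, since \<open>?H\<close> is Hermitian.\<close>

lemma normal_equation_solvable:
  fixes A :: "complex^'m^'n"
  obtains X where "dagger A ** A ** X = dagger A"
proof -
  let ?H = "dagger A ** A"
  obtain G where G: "?H ** G ** ?H = ?H"
    by (rule inner_inverse_exists)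
  define D where "D = A ** G ** ?H - A"
  have "dagger A ** D = 0"
    using G by (simp add: D_def matrix_diff_ldistrib matrix_mul_assoc)
  moreover have "D = A ** (G ** ?H - mat 1)"
    by (simp add: D_def matrix_diff_ldistrib matrix_mul_assoc)
  ultimately have "dagger D ** D = 0"
    by (metis dagger_mult matrix_mul_assoc times0_right)
  then have "D = 0" by (rule mult_dagger_eq_0)
  then have "dagger (A ** G ** ?H) = dagger A"
    by (simp add: D_def)
  then have "?H ** (dagger G ** dagger A) = dagger A"
    by (simp add: dagger_mult matrix_mul_assoc)
  then show ?thesis
    using that by blast
qed

lemma least_squares_inverse_exists:
  fixes A :: "complex^'m^'n"
  obtains X where "A ** X ** A = A" "dagger (A ** X) = A ** X"
proof -
  obtain X where X: "dagger A ** A ** X = dagger A"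
    by (rule normal_equation_solvable)
  \<comment> \<open>The left side is Hermitian whatever \<open>X\<close> is, so
    \<open>A ** X\<close> inherits this.\<close>
  have "dagger (A ** X) ** (A ** X) = dagger (A ** X)"
    by (metis X dagger_mult matrix_mul_assoc)
  then have h: "dagger (A ** X) = A ** X"
    by (metis dagger_dagger dagger_mult)
  have "A = dagger (A ** X) ** A"
    by (metis X dagger_dagger dagger_mult matrix_mul_assoc)
  with h that show ?thesis by metis
qed

lemma is_pinv_exists:
  fixes A :: "complex^'m^'n"
  obtains Y where "is_pinv A Y"
proof -
  obtain X where X: "A ** X ** A = A" "dagger (A ** X) = A ** X"
    by (rule least_squares_inverse_exists)
  obtain W where W: "dagger A ** W ** dagger A = dagger A" "dagger (dagger A ** W) = dagger A ** W"
    by (rule least_squares_inverse_exists)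
  \<comment> \<open>Passing to adjoints moves the Hermitian condition from the product with
    \<open>A\<close> on the left to the one with \<open>A\<close> on the right. \<open>X\<close> and
    \<open>Z\<close> thus supply one symmetry each, and \<open>Z ** A ** X\<close> has both.\<close>
  define Z where "Z = dagger W"
  have Z: "A ** Z ** A = A" "dagger (Z ** A) = Z ** A"
    using W by (metis Z_def dagger_dagger dagger_mult matrix_mul_assoc)+
  let ?Y = "Z ** A ** X"
  have AY: "A ** ?Y = A ** X" and YA: "?Y ** A = Z ** A"
    using X Z by (metis matrix_mul_assoc)+
  then have "is_pinv A ?Y"
    unfolding is_pinv_def using X Z by (metis matrix_mul_assoc)
  then show ?thesis
    using that by blast
qed

text \<open>\<open>A ** Y\<close> and \<open>A ** Z\<close> are Hermitian and each absorbs the other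
  on its right, so taking adjoints makes them equal; likewise for \<open>Y ** A\<close> and
  \<open>Z ** A\<close>. Then Y = YAY = ZAY = ZAZ = Z.\<close>

lemma is_pinv_unique:
  assumes "is_pinv A Y" "is_pinv A Z"
  shows "Y = Z"
proof -
  note y = assms(1)[unfolded is_pinv_def] and z = assms(2)[unfolded is_pinv_def]
  have "A ** Y = dagger (A ** Y)" using y by simp
  also have "\<dots> = dagger (A ** Z ** (A ** Y))" using z by (simp add: matrix_mul_assoc)
  also have "\<dots> = A ** Y ** (A ** Z)" using y z by (simp only: dagger_mult[of "A ** Z"])
  also have "\<dots> = A ** Z" using y by (simp add: matrix_mul_assoc)
  finally have 1: "A ** Y = A ** Z" .
  have "Y ** A = dagger (Y ** A)" using y by simp
  also have "\<dots> = dagger (Y ** A ** (Z ** A))" using z by (metis matrix_mul_assoc)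
  also have "\<dots> = Z ** A ** (Y ** A)" using y z by (simp only: dagger_mult[of "Y ** A"])
  also have "\<dots> = Z ** A" using y by (metis matrix_mul_assoc)
  finally have 2: "Y ** A = Z ** A" .
  show ?thesis
    using 1 2 y z by (metis matrix_mul_assoc)
qed

lemma is_pinv_pinv: "is_pinv A (pinv A)"
  unfolding pinv_def by (metis is_pinv_exists is_pinv_unique theI)

lemma pinv_mult_orthogonal_projector:
  "orthogonal_projector_onto (pinv A ** A) (Supp A)"
proof -
  let ?P = "pinv A ** A"
  have p: "A ** pinv A ** A = A" "pinv A ** A ** pinv A = pinv A" "dagger ?P = ?P"
    using is_pinv_pinv[of A] by (auto simp: is_pinv_def)
  have "range ((*v) ?P) = Supp A"
  proof (intro equalityI subsetI)
    fix u assume "u \<in> range ((*v) ?P)"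
    then obtain w where w: "u = ?P *v w" by auto
    have "cinner v u = 0" if "A *v v = 0" for v
      using that unfolding w cinner_adjoint p
      by (simp add: matrix_vector_mul_assoc [symmetric] cinner_def)
    then show "u \<in> Supp A"
      by (simp add: Supp_def ocompl_def Ker_def)
  next
    fix u assume u: "u \<in> Supp A"
    \<comment> \<open>This vector lies in the kernel of \<open>A\<close>. It is orthogonal to
      \<open>u\<close> because \<open>u\<close> is in the support, and to \<open>?P *v u\<close>
      because \<open>?P\<close> is Hermitian and kills it; hence it is 0.\<close>
    let ?v = "u - ?P *v u"
    have "A *v ?v = 0"
      using p by (simp add: matrix_vector_mult_diff_distrib matrix_vector_mul_assoc matrix_mul_assoc)
    then have "cinner ?v u = 0" and "?P *v ?v = 0"
      using u by (simp_all add: Supp_def ocompl_def Ker_def matrix_vector_mul_assoc [symmetric])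
    moreover from this have "cinner ?v (?P *v u) = 0"
      by (simp only: cinner_adjoint p(3) cinner_0_left)
    ultimately have "cinner ?v ?v = 0"
      by (simp only: cinner_right_diff[of ?v] diff_self)
    then show "u \<in> range ((*v) ?P)"
      by (metis cinner_self_eq_0_iff eq_iff_diff_eq_0 rangeI)
  qed
  with p show ?thesis
    by (simp add: orthogonal_projector_onto_def matrix_mul_assoc)
qed

section \<open>Vectorization and tensor products\<close>

text \<open>Gives access to the product rule, continuity and norm bounds for matrix
  products.\<close>

lemma bounded_bilinear_matrix_mult:
  "bounded_bilinear ((**) :: complex^'m^'n \<Rightarrow> complex^'k^'m \<Rightarrow> _)"
  unfolding bilinear_conv_bounded_bilinear [symmetric] bilinear_def
  by (auto intro!: linearI simp: vec_eq_iff matrix_matrix_mult_def sum.distrib algebra_simps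
      scaleR_sum_right)

lemma bounded_bilinear_matrix_vector_mult:
  "bounded_bilinear ((*v) :: complex^'m^'n \<Rightarrow> complex^'m \<Rightarrow> _)"
  unfolding bilinear_conv_bounded_bilinear [symmetric] bilinear_def
  by (auto intro!: linearI simp: vec_eq_iff matrix_vector_mult_def sum.distrib algebra_simps
      scaleR_sum_right)

lemma sum_UNIV_prod: "(\<Sum>p\<in>(UNIV::('a::finite \<times> 'b::finite) set). f p) = (\<Sum>i\<in>UNIV. \<Sum>j\<in>UNIV. f (i, j))"
  by (simp add: UNIV_Times_UNIV[symmetric] sum.cartesian_product del: UNIV_Times_UNIV)

text \<open>Both sides have the entry sum over k, l of X_ik Z_kl Y_lj at (i, j). The transpose
  appears because \<open>Y\<close> acts on the column index of \<open>Z\<close>.\<close>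

lemma vectorization_triple:
  "vectorization (X ** Z ** Y) = (X \<otimes> transpose Y) *v vectorization Z"
  by (simp add: vectorization_def kron_def transpose_def matrix_matrix_mult_def
      matrix_vector_mult_def vec_eq_iff sum_UNIV_prod sum_distrib_left sum_distrib_right algebra_simps)
    (intro allI, rule sum.swap)

lemma bij_vectorization: "bij (vectorization :: complex^'a^'a \<Rightarrow> _)"
proof (rule bijI)
  show "inj (vectorization :: complex^'a^'a \<Rightarrow> _)"
    by (rule injI) (auto simp: vectorization_def vec_eq_iff)
  show "surj (vectorization :: complex^'a^'a \<Rightarrow> _)"
    by (rule surjI[of _ "\<lambda>v. \<chi> i j. v $ (i, j)"]) (simp add: vectorization_def vec_eq_iff)
qed

lemma vectorization_anticommutator:
  "vectorization ((1/2) *\<^sub>R (B ** X + X ** B)) =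
    ((1/2) *\<^sub>R (B \<otimes> mat 1 + mat 1 \<otimes> transpose B)) *v vectorization X"
proof -
  have "vectorization (B ** X) = (B \<otimes> mat 1) *v vectorization X"
    using vectorization_triple[of B X "mat 1"] by simp
  moreover have "vectorization (X ** B) = (mat 1 \<otimes> transpose B) *v vectorization X"
    using vectorization_triple[of "mat 1" X B] by simp
  moreover have "vectorization ((1/2) *\<^sub>R (Y + Z)) = (1/2) *\<^sub>R (vectorization Y + vectorization Z)"
    for Y Z :: "complex^'a^'a"
    by (simp add: vectorization_def vec_eq_iff)
  ultimately show ?thesis
    by (simp only: bounded_bilinear.scaleR_left[OF bounded_bilinear_matrix_vector_mult] matrix_vector_mult_add_rdistrib)
qed

text \<open>\<open>X \<otimes> mat 1\<close> is block diagonal: it acts by \<open>X\<close> on each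
  slice of \<open>v\<close> with fixed second index.\<close>

lemma cinner_kron_mat_1:
  "cinner v ((X \<otimes> mat 1) *v v) =
    (\<Sum>b\<in>UNIV. cinner (\<chi> a. v $ (a, b)) (X *v (\<chi> a. v $ (a, b))))"
proof -
  have "((X \<otimes> mat 1) *v v) $ (a, b) = (X *v (\<chi> a. v $ (a, b))) $ a" for a b
    by (simp add: kron_def mat_def matrix_vector_mult_def sum_UNIV_prod if_distrib if_distribR cong: if_cong)
  then show ?thesis
    by (simp add: cinner_def sum_UNIV_prod) (rule sum.swap)
qed

lemma inner_kron_mat_1_pos:
  assumes pos: "\<And>w. w \<noteq> 0 \<Longrightarrow> 0 < inner w (X *v w)" and "v \<noteq> 0"
  shows "0 < inner v ((X \<otimes> mat 1) *v v)"
proof -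
  let ?w = "\<lambda>b. \<chi> a. v $ (a, b)"
  from \<open>v \<noteq> 0\<close> obtain a b where "v $ (a, b) \<noteq> 0"
    by (auto simp: vec_eq_iff)
  then have "?w b \<noteq> 0" by (auto simp: vec_eq_iff)
  moreover have nonneg: "0 \<le> inner w (X *v w)" for w
    using pos[of w] by (cases "w = 0") (auto intro: less_imp_le)
  ultimately have "0 < (\<Sum>b\<in>UNIV. inner (?w b) (X *v ?w b))"
    using pos nonneg by (intro sum_pos2[of _ b]) auto
  then show ?thesis
    by (simp flip: Re_cinner add: cinner_kron_mat_1)
qed

text \<open>\<open>Z\<close> is |v><v|, so \<open>X ** Z\<close> is |Xv><v|. The other product is
  its adjoint, both factors being Hermitian.\<close>

lemma anticommutator_kernel:
  assumes "dagger X = X" and "X *v v = 0"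
  defines "Z \<equiv> \<chi> i j. v $ i * cnj (v $ j)"
  shows "X ** Z = 0" and "Z ** X = 0"
proof -
  show *: "X ** Z = 0"
    using assms(2)
    by (simp add: Z_def vec_eq_iff matrix_matrix_mult_def matrix_vector_mult_def
        mult.assoc [symmetric] sum_distrib_right [symmetric])
  have "dagger Z = Z"
    by (simp add: Z_def dagger_def vec_eq_iff)
  then have "Z ** X = dagger (X ** Z)"
    by (simp add: dagger_mult assms(1))
  with * show "Z ** X = 0"
    by (simp add: dagger_def vec_eq_iff)
qed

section \<open>The matrix exponential\<close>

lemma has_vector_derivative_vec:
  fixes f :: "real \<Rightarrow> 'c::real_normed_vector^'n"
  assumes "\<And>i. ((\<lambda>t. f t $ i) has_vector_derivative D $ i) (at t within S)"
  shows "(f has_vector_derivative D) (at t within S)"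
  using assms
  by (auto simp: has_vector_derivative_def has_derivative_within bounded_linear_scaleR_left
      intro!: vec_tendstoI)

lemma matpow_0: "matpow X 0 = mat 1"
  and matpow_Suc: "matpow X (Suc k) = X ** matpow X k"
  by (simp_all add: matpow_def)

lemma matpow_commute: "X ** matpow X k = matpow X k ** X"
  by (induction k) (simp_all add: matpow_0 matpow_Suc matrix_mul_assoc)

lemma matpow_scaleR: "matpow (t *\<^sub>R X) k = t ^ k *\<^sub>R matpow X k"
  by (induction k) (simp_all add: matpow_0 matpow_Suc
      bounded_bilinear.scaleR_left[OF bounded_bilinear_matrix_mult]
      bounded_bilinear.scaleR_right[OF bounded_bilinear_matrix_mult])

text \<open>The sum of all entry norms dominates every row sum, which is what the induction needs;
  it makes each entry of the exponential series comparable to a scalar one.\<close>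

lemma norm_matpow_le:
  "norm (matpow X k $ i $ j) \<le> (\<Sum>i\<in>UNIV. \<Sum>j\<in>UNIV. norm (X $ i $ j)) ^ k"
proof (induction k arbitrary: i)
  case (Suc k)
  let ?c = "\<Sum>i\<in>UNIV. \<Sum>j\<in>UNIV. norm (X $ i $ j)"
  have c: "?c \<ge> 0" by (intro sum_nonneg) auto
  have "norm (matpow X (Suc k) $ i $ j) \<le> (\<Sum>l\<in>UNIV. norm (X $ i $ l) * norm (matpow X k $ l $ j))"
    unfolding matpow_Suc matrix_matrix_mult_def
    by (simp add: norm_mult [symmetric] norm_sum)
  also have "\<dots> \<le> (\<Sum>l\<in>UNIV. norm (X $ i $ l)) * ?c ^ k"
    unfolding sum_distrib_right by (intro sum_mono mult_left_mono Suc.IH) auto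
  also have "\<dots> \<le> ?c * ?c ^ k"
    using c by (intro mult_right_mono zero_le_power member_le_sum) (auto intro: sum_nonneg)
  finally show ?case by simp
qed (simp add: matpow_0 mat_def)

text \<open>The variable \<open>z\<close> is complex so that each entry is an entire power series
  and can be differentiated termwise.\<close>

lemma summable_matpow_entry:
  "summable (\<lambda>k. matpow X k $ i $ j / fact k * z ^ k)"
proof (rule summable_comparison_test')
  let ?c = "\<Sum>i\<in>UNIV. \<Sum>j\<in>UNIV. norm (X $ i $ j)"
  show "summable (\<lambda>k. (?c * norm z) ^ k /\<^sub>R fact k)"
    by (rule summable_exp_generic)
  show "norm (matpow X k $ i $ j / fact k * z ^ k) \<le> (?c * norm z) ^ k /\<^sub>R fact k" if "k \<ge> 0" for k
    using norm_matpow_le[of X k i j]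
    by (simp add: norm_mult norm_divide norm_power power_mult_distrib divide_simps mult_right_mono)
qed

lemma mexp_entry:
  "mexp (t *\<^sub>R X) $ i $ j = (\<Sum>k. matpow X k $ i $ j / fact k * of_real t ^ k)"
proof -
  let ?a = "\<lambda>k. (1 / fact k) *\<^sub>R matpow (t *\<^sub>R X) k"
  let ?S = "\<chi> i j. \<Sum>k. matpow X k $ i $ j / fact k * of_real t ^ k"
  have "(\<lambda>k. ?a k $ i $ j) sums (?S $ i $ j)" for i j
  proof -
    have "?a k $ i $ j = matpow X k $ i $ j / fact k * of_real t ^ k" for k
      by (simp add: matpow_scaleR) (simp add: scaleR_conv_of_real)
    then show ?thesis
      by (simp only: vec_lambda_beta) (rule summable_sums[OF summable_matpow_entry])
  qed
  \<comment> \<open>Entrywise convergence makes the matrix series converge, so the infinite sum in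
    \<open>mexp\<close> is a genuine limit.\<close>
  then have "?a sums ?S"
    unfolding sums_def by (intro vec_tendstoI) simp
  then have "mexp (t *\<^sub>R X) = ?S"
    unfolding mexp_def by (rule sums_unique [symmetric])
  then show ?thesis by simp
qed

lemma mexp_0: "mexp (0 *\<^sub>R X) = mat 1"
  using powser_zero[of "\<lambda>k. matpow X k $ i $ j / fact k" for i j]
  by (simp only: vec_eq_iff mexp_entry) (simp add: matpow_0)

lemma mexp_commute: "X ** mexp (t *\<^sub>R X) = mexp (t *\<^sub>R X) ** X"
proof -
  have "(X ** mexp (t *\<^sub>R X)) $ i $ j = (\<Sum>l\<in>UNIV. \<Sum>k. X $ i $ l * (matpow X k $ l $ j / fact k * of_real t ^ k))" for i j
    by (simp only: matrix_matrix_mult_def vec_lambda_beta mexp_entry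
        suminf_mult[OF summable_matpow_entry])
  also have "\<dots> i j = (\<Sum>k. \<Sum>l\<in>UNIV. X $ i $ l * (matpow X k $ l $ j / fact k * of_real t ^ k))" for i j
    by (intro suminf_sum [symmetric] summable_mult summable_matpow_entry)
  also have "\<dots> i j = (\<Sum>k. (X ** matpow X k) $ i $ j / fact k * of_real t ^ k)" for i j
    by (simp add: matrix_matrix_mult_def sum_divide_distrib sum_distrib_right mult.assoc)
  also have "\<dots> i j = (\<Sum>k. (matpow X k ** X) $ i $ j / fact k * of_real t ^ k)" for i j
    by (simp add: matpow_commute)
  also have "\<dots> i j = (\<Sum>k. \<Sum>l\<in>UNIV. (matpow X k $ i $ l / fact k * of_real t ^ k) * X $ l $ j)" for i j
    by (simp add: matrix_matrix_mult_def sum_divide_distrib sum_distrib_left sum_distrib_right algebra_simps)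
  also have "\<dots> i j = (\<Sum>l\<in>UNIV. \<Sum>k. (matpow X k $ i $ l / fact k * of_real t ^ k) * X $ l $ j)" for i j
    by (intro suminf_sum summable_mult2 summable_matpow_entry)
  also have "\<dots> i j = (mexp (t *\<^sub>R X) ** X) $ i $ j" for i j
    by (simp only: matrix_matrix_mult_def vec_lambda_beta mexp_entry
        suminf_mult2[OF summable_matpow_entry])
  finally show ?thesis by (simp add: vec_eq_iff)
qed

lemma mexp_has_vector_derivative:
  "((\<lambda>t. mexp (t *\<^sub>R X)) has_vector_derivative X ** mexp (t *\<^sub>R X)) (at t within S)"
proof (intro has_vector_derivative_vec)
  fix i j
  let ?c = "\<lambda>k. matpow X k $ i $ j / fact k"
  \<comment> \<open>The shifted coefficient is (k+1) times an entry of the power k+1 over (k+1)!;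
    the factor cancels and leaves one extra \<open>X\<close> on the left.\<close>
  have "diffs ?c k = (X ** matpow X k) $ i $ j / fact k" for k
    by (simp add: diffs_def matpow_Suc divide_simps del: of_nat_Suc)
  then have "(\<Sum>k. diffs ?c k * of_real t ^ k)
      = (\<Sum>k. \<Sum>l\<in>UNIV. X $ i $ l * (matpow X k $ l $ j / fact k * of_real t ^ k))"
    by (simp add: matrix_matrix_mult_def sum_divide_distrib sum_distrib_right mult.assoc)
  also have "\<dots> = (\<Sum>l\<in>UNIV. \<Sum>k. X $ i $ l * (matpow X k $ l $ j / fact k * of_real t ^ k))"
    by (intro suminf_sum summable_mult summable_matpow_entry)
  also have "\<dots> = (X ** mexp (t *\<^sub>R X)) $ i $ j"
    by (simp only: matrix_matrix_mult_def vec_lambda_beta mexp_entry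
        suminf_mult[OF summable_matpow_entry])
  finally have "((\<lambda>z. \<Sum>k. ?c k * z ^ k) has_field_derivative (X ** mexp (t *\<^sub>R X)) $ i $ j) (at (of_real t))"
    using termdiffs_strong_converges_everywhere[of ?c "of_real t"] summable_matpow_entry[of X i j]
    by metis
  then show "((\<lambda>t. mexp (t *\<^sub>R X) $ i $ j) has_vector_derivative (X ** mexp (t *\<^sub>R X)) $ i $ j) (at t within S)"
    unfolding mexp_entry by (rule has_vector_derivative_real_field)
qed

section \<open>The Lyapunov equation\<close>

lemma norm_axis: "norm (axis i x :: 'c::real_normed_vector^'n) = norm x"
  by (simp add: norm_vec_def L2_set_def axis_def if_distrib [of norm] if_distrib [of "\<lambda>x. x\<^sup>2"] cong: if_cong)

text \<open>The constant is the minimum of the form on the compact unit sphere; homogeneity of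
  degree 2 extends the bound to all vectors.\<close>

lemma inner_quadratic_form_lower_bound:
  fixes B :: "complex^'n^'n"
  assumes "\<And>v. v \<noteq> 0 \<Longrightarrow> 0 < inner v (B *v v)"
  obtains l where "l > 0" "\<And>v. l * (norm v)\<^sup>2 \<le> inner v (B *v v)"
proof -
  let ?S = "sphere (0 :: complex^'n) 1"
  \<comment> \<open>Only shows that the sphere is nonempty.\<close>
  have "axis undefined 1 \<in> ?S"
    by (simp add: norm_axis)
  moreover have "continuous_on ?S (\<lambda>v. inner v (B *v v))"
    by (intro continuous_intros linear_continuous_on matrix_vector_mul_bounded_linear)
  ultimately obtain u where u: "u \<in> ?S" "\<And>v. v \<in> ?S \<Longrightarrow> inner u (B *v u) \<le> inner v (B *v v)"
    using continuous_attains_inf[of ?S "\<lambda>v. inner v (B *v v)"] by (metis compact_sphere empty_iff)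
  show ?thesis
  proof
    show "inner u (B *v u) > 0"
      using u(1) by (intro assms) auto
    show "inner u (B *v u) * (norm v)\<^sup>2 \<le> inner v (B *v v)" for v
    proof (cases "v = 0")
      case False
      let ?w = "(1 / norm v) *\<^sub>R v"
      have "inner u (B *v u) \<le> inner ?w (B *v ?w)"
        using False by (intro u(2)) simp
      also have "\<dots> = inner v (B *v v) / (norm v)\<^sup>2"
        by (simp add: linear_scale[OF matrix_vector_mul_linear] power2_eq_square)
      finally show ?thesis
        using False by (simp add: field_simps)
    qed simp
  qed
qed

lemma mexp_minus_has_vector_derivative:
  "((\<lambda>t. mexp (- t *\<^sub>R B)) has_vector_derivative - (B ** mexp (- t *\<^sub>R B))) (at t within S)"
proof -
  have "(uminus has_vector_derivative - 1) (at t within S)" for t :: real and S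
    by (auto intro!: derivative_eq_intros)
  from vector_diff_chain_within[OF this mexp_has_vector_derivative]
  show ?thesis by (simp add: o_def)
qed

text \<open>Along \<open>x = exp (-tB) v\<close> the derivative of \<open>\<bar>x\<bar>\<^sup>2\<close> is \<open>-2 <x, B x> \<le> -2 l \<bar>x\<bar>\<^sup>2\<close>.\<close>

lemma norm_mexp_mult_vec_le:
  assumes l: "\<And>v. l * (norm v)\<^sup>2 \<le> inner v (B *v v)" and "t \<ge> 0"
  shows "norm (mexp (- t *\<^sub>R B) *v v) \<le> exp (- l * t) * norm v"
proof -
  define x where "x t = mexp (- t *\<^sub>R B) *v v" for t
  \<comment> \<open>The integrating factor turns the differential inequality into the statement that
    \<open>F\<close> does not increase from \<open>F 0\<close>, the squared norm of
    \<open>v\<close>.\<close>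
  define F where "F t = exp (2 * l * t) * inner (x t) (x t)" for t
  have x': "(x has_vector_derivative - (B *v x t)) (at t)" for t
  proof -
    have "(x has_vector_derivative - (B ** mexp (- t *\<^sub>R B)) *v v) (at t)"
      unfolding x_def
      by (intro bounded_linear.has_vector_derivative[OF
          bounded_bilinear.bounded_linear_left[OF bounded_bilinear_matrix_vector_mult]]
          mexp_minus_has_vector_derivative)
    then show ?thesis
      by (simp add: x_def bounded_bilinear.minus_left[OF bounded_bilinear_matrix_vector_mult]
          matrix_vector_mul_assoc)
  qed
  have F': "(F has_real_derivative 2 * exp (2 * l * t) * (l * (norm (x t))\<^sup>2 - inner (x t) (B *v x t))) (at t)" for t
  proof -
    have "((\<lambda>t. inner (x t) (x t)) has_vector_derivative - 2 * inner (x t) (B *v x t)) (at t)"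
      using bounded_bilinear.has_vector_derivative[OF bounded_bilinear_inner x' x']
      by (simp add: inner_commute)
    then have "((\<lambda>t. inner (x t) (x t)) has_real_derivative - 2 * inner (x t) (B *v x t)) (at t)"
      by (simp add: has_real_derivative_iff_has_vector_derivative)
    then show ?thesis
      unfolding F_def
      by (auto intro!: derivative_eq_intros simp: power2_norm_eq_inner algebra_simps)
  qed
  have "F t \<le> F 0"
    using \<open>t \<ge> 0\<close> l F'
    by (intro DERIV_nonpos_imp_nonincreasing[of 0 t F])
      (meson diff_le_0_iff_le exp_ge_zero mult_nonneg_nonpos zero_le_mult_iff zero_le_numeral)+
  moreover have "x 0 = v"
    by (simp add: x_def mexp_0[of B, simplified])
  ultimately have "exp (2 * l * t) * (norm (x t))\<^sup>2 \<le> (norm v)\<^sup>2"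
    by (simp add: F_def power2_norm_eq_inner)
  moreover have "(exp (l * t) * norm (x t))\<^sup>2 = exp (2 * l * t) * (norm (x t))\<^sup>2"
    by (simp add: power_mult_distrib exp_double [symmetric] mult.assoc)
  ultimately have "exp (l * t) * norm (x t) \<le> norm v"
    by (metis norm_ge_zero power2_le_imp_le)
  then show ?thesis
    by (simp add: x_def exp_minus field_simps)
qed

text \<open>A crude passage from bounds on vectors to a bound on the matrix norm; only the
  exponential rate matters later, not the constant.\<close>

lemma norm_matrix_le_sum_columns:
  fixes X :: "complex^'m^'n"
  shows "norm X \<le> real CARD('n) * (\<Sum>j\<in>UNIV. norm (X *v axis j 1))"
proof -
  have col: "(X *v axis j 1) $ i = X $ i $ j" for i j
    by (simp add: matrix_vector_mult_def axis_def if_distrib cong: if_cong)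
  have "norm X \<le> (\<Sum>i\<in>UNIV. norm (X $ i))"
    by (simp add: norm_vec_def L2_set_le_sum)
  also have "\<dots> \<le> (\<Sum>i\<in>(UNIV::'n set). \<Sum>j\<in>UNIV. norm (X *v axis j 1))"
  proof (intro sum_mono)
    fix i
    have "norm (X $ i) \<le> (\<Sum>j\<in>UNIV. norm (X $ i $ j))"
      by (simp add: norm_vec_def L2_set_le_sum)
    also have "\<dots> \<le> (\<Sum>j\<in>UNIV. norm (X *v axis j 1))"
      by (intro sum_mono) (simp only: col [symmetric] Finite_Cartesian_Product.norm_nth_le)
    finally show "norm (X $ i) \<le> (\<Sum>j\<in>UNIV. norm (X *v axis j 1))" .
  qed
  finally show ?thesis by simp
qed

lemma norm_mexp_le:
  fixes B :: "complex^'n^'n"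
  assumes "\<And>v. l * (norm v)\<^sup>2 \<le> inner v (B *v v)" and "t \<ge> 0"
  shows "norm (mexp (- t *\<^sub>R B)) \<le> (real CARD('n))\<^sup>2 * exp (- l * t)"
proof -
  have "norm (mexp (- t *\<^sub>R B)) \<le> real CARD('n) * (\<Sum>j\<in>(UNIV::'n set). exp (- l * t))"
    using norm_mexp_mult_vec_le[OF assms, where v = "axis _ 1"]
    by (intro order_trans[OF norm_matrix_le_sum_columns] mult_left_mono sum_mono)
      (simp_all only: norm_axis norm_one mult_1_right of_nat_0_le_iff)
  then show ?thesis by (simp add: power2_eq_square)
qed

lemma lyapunov_integral:
  fixes B X :: "complex^'n^'n"
  assumes pos: "\<And>v. v \<noteq> 0 \<Longrightarrow> 0 < inner v (B *v v)"
  defines "f \<equiv> \<lambda>t. mexp (- t *\<^sub>R B) ** (B ** X + X ** B) ** mexp (- t *\<^sub>R B)"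
  shows "f absolutely_integrable_on {0..}" and "(f has_integral X) {0..}"
proof -
  obtain l where l: "l > 0" "\<And>v. l * (norm v)\<^sup>2 \<le> inner v (B *v v)"
    using inner_quadratic_form_lower_bound[OF pos] by blast
  note bb = bounded_bilinear_matrix_mult
  define E where "E t = mexp (- t *\<^sub>R B)" for t
  have E': "(E has_vector_derivative - (B ** E t)) (at t within S)" for t S
    unfolding E_def by (rule mexp_minus_has_vector_derivative)
  have E_commute: "E t ** B = B ** E t" for t
    unfolding E_def by (rule mexp_commute [symmetric])
  have f_eq: "f t = E t ** (B ** X + X ** B) ** E t" for t
    by (simp only: f_def E_def)
  define C where "C = (real CARD('n))\<^sup>2"
  have E_le: "norm (E t) \<le> C * exp (- l * t)" if "t \<ge> 0" for t
    unfolding E_def C_def using l(2) that by (rule norm_mexp_le)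
  obtain K where K: "K > 0" "\<And>(Y :: complex^'n^'n) (Z :: complex^'n^'n). norm (Y ** Z) \<le> norm Y * norm Z * K"
    using bounded_bilinear.pos_bounded[OF bb] by blast
  \<comment> \<open>Two factors \<open>E t\<close> double the decay rate. The bound serves twice:
    for the integrand and for its antiderivative.\<close>
  have sandwich: "norm (E t ** Y ** E t) \<le> (C\<^sup>2 * K\<^sup>2 * norm Y) * exp (- (2 * l) * t)" if "t \<ge> 0" for t Y
  proof -
    have "norm (E t ** Y ** E t) \<le> (norm (E t) * norm Y * K) * norm (E t) * K"
      by (rule order_trans[OF K(2)]) (intro mult_right_mono K(2), use K(1) in auto)
    also have "\<dots> = (norm (E t))\<^sup>2 * (K\<^sup>2 * norm Y)"
      by (simp add: power2_eq_square)
    also have "\<dots> \<le> (C * exp (- l * t))\<^sup>2 * (K\<^sup>2 * norm Y)"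
      by (intro mult_right_mono power_mono E_le that) auto
    also have "\<dots> = (C\<^sup>2 * K\<^sup>2 * norm Y) * exp (- (2 * l) * t)"
      by (simp add: power_mult_distrib exp_double [symmetric] mult.assoc)
    finally show ?thesis .
  qed
  define g where "g t = (C\<^sup>2 * K\<^sup>2 * norm (B ** X + X ** B)) * exp (- (2 * l) * t)" for t
  have f_le: "norm (f t) \<le> g t" if "t \<ge> 0" for t
    using sandwich[OF that] by (simp only: f_eq g_def)
  have g: "g integrable_on {0..}"
    unfolding g_def using has_integral_exp_minus_to_infinity[of "2 * l" 0] l(1)
    by (intro integrable_on_mult_right) (auto simp: integrable_on_def)
  \<comment> \<open>An antiderivative of \<open>f\<close>: since \<open>E t\<close> commutes with
    \<open>B\<close>, the product rule yields both terms of the anticommutator.\<close>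
  define G where "G t = - (E t ** X ** E t)" for t
  have G': "(G has_vector_derivative f t) (at t within S)" for t S
  proof -
    have "(G has_vector_derivative - (E t ** X ** (- (B ** E t)) + (- (B ** E t) ** X) ** E t)) (at t within S)"
      unfolding G_def
      by (intro has_vector_derivative_minus bounded_bilinear.has_vector_derivative[OF bb]
          bounded_linear.has_vector_derivative[OF bounded_bilinear.bounded_linear_left[OF bb]] E')
    also have "- (E t ** X ** (- (B ** E t)) + (- (B ** E t) ** X) ** E t) = f t"
      by (simp add: f_eq bounded_bilinear.minus_left[OF bb] bounded_bilinear.minus_right[OF bb]
          matrix_add_ldistrib bounded_bilinear.add_left[OF bb] matrix_mul_assoc E_commute)
    finally show ?thesis .
  qed
  have "continuous_on S f" for S
  proof -
    have "continuous_on S E"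
      by (intro continuous_at_imp_continuous_on ballI has_vector_derivative_continuous[OF E'])
    then show ?thesis
      unfolding f_eq
      by (intro bounded_bilinear.continuous_on[OF bb] continuous_on_const)
  qed
  then have "f \<in> borel_measurable (lebesgue_on {0..})"
    by (rule continuous_imp_measurable_on_sets_lebesgue) auto
  then show "f absolutely_integrable_on {0..}"
    by (rule measurable_bounded_by_integrable_imp_absolutely_integrable[where g = g]) (use f_le g in auto)
  \<comment> \<open>Truncations to [0, k] have integral \<open>G k - G 0\<close> by the fundamental
    theorem; dominated convergence with bound \<open>g\<close> then reaches the half-line.\<close>
  let ?f = "\<lambda>k t. if t \<in> {0..real k} then f t else 0"
  have "(f has_integral G (real k) - G 0) {0..real k}" for k
    by (rule fundamental_theorem_of_calculus) (auto intro: G')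
  then have "(?f k has_integral G (real k) - G 0) {0..}" for k
    by (subst has_integral_restrict) auto
  then show "(f has_integral X) {0..}"
  proof (rule has_integral_dominated_convergence[OF _ g])
    show "\<forall>t\<in>{0..}. norm (?f k t) \<le> g t" for k
      using f_le by (auto intro: order_trans[OF norm_ge_zero])
    show "\<forall>t\<in>{0..}. (\<lambda>k. ?f k t) \<longlonglongrightarrow> f t"
    proof
      fix t :: real assume "t \<in> {0..}"
      then have "?f k t = f t" if "k \<ge> nat \<lceil>t\<rceil>" for k
        using that by (auto simp: nat_ceiling_le_eq)
      then show "(\<lambda>k. ?f k t) \<longlonglongrightarrow> f t"
        by (intro tendsto_eventually eventually_sequentiallyI)
    qed
    have "((\<lambda>k. (C\<^sup>2 * K\<^sup>2 * norm X) * exp (- (2 * l) * real k)) \<longlonglongrightarrow> 0)"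
      \<comment> \<open>Along the integers the exponential is a geometric sequence with ratio below
        1.\<close>
      unfolding exp_of_nat2_mult using l(1)
      by (intro tendsto_mult_right_zero LIMSEQ_power_zero) simp
    then have "(\<lambda>k. G (real k)) \<longlonglongrightarrow> 0"
      by (rule Lim_null_comparison[rotated])
        (simp only: G_def norm_minus_cancel sandwich of_nat_0_le_iff eventually_True)
    moreover have "G 0 = - X"
      by (simp add: G_def E_def mexp_0[of B, simplified])
    ultimately show "(\<lambda>k. G (real k) - G 0) \<longlonglongrightarrow> X"
      using tendsto_add[of "\<lambda>k. G (real k)" 0 sequentially "\<lambda>_. X" X] by simp
  qed
qed

section \<open>Pseudo-density matrices\<close>

theorem mainTheorem2:
  fixes n :: nat
    and \<rho> :: "complex^'a^'a"
    and \<E> :: "complex^'a^'a \<Rightarrow> complex^'b^'b"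
    and M R \<rho>t :: "complex^('a \<times> 'b)^('a \<times> 'b)"
    and A :: "complex^(('a \<times> 'b) \<times> ('a \<times> 'b))^(('a \<times> 'b) \<times> ('a \<times> 'b))"
  assumes "CARD('a) = 2 ^ n" and "CARD('b) = 2 ^ n"
    and "density_matrix \<rho>"
    and "completely_positive \<E>" and "trace_preserving \<E>"
    and "M = choi \<E>"
    and "R = Rmap \<rho> M"
    and "\<rho>t = \<rho> \<otimes> mat 1"
    and "A = (1/2) *\<^sub>R (\<rho>t \<otimes> mat 1 + mat 1 \<otimes> transpose \<rho>t)"
  shows "vectorization R = A *v vectorization M
    \<and> (rank \<rho> = CARD('a) \<longrightarrow>
         invertible A
       \<and> bij (Rmap \<rho> :: complex^('a \<times> 'b)^('a \<times> 'b) \<Rightarrow> _)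
       \<and> vectorization M = matrix_inv A *v vectorization R
       \<and> (\<lambda>t::real. mexp (- t *\<^sub>R \<rho>t) ** R ** mexp (- t *\<^sub>R \<rho>t)) absolutely_integrable_on {0..}
       \<and> M = 2 *\<^sub>R integral {0..} (\<lambda>t::real. mexp (- t *\<^sub>R \<rho>t) ** R ** mexp (- t *\<^sub>R \<rho>t)))
    \<and> (rank \<rho> < CARD('a) \<longrightarrow>
         rank A < CARD(('a \<times> 'b) \<times> ('a \<times> 'b))
       \<and> \<not> bij (Rmap \<rho> :: complex^('a \<times> 'b)^('a \<times> 'b) \<Rightarrow> _)
       \<and> (let P = pinv A ** A in
            orthogonal_projector_onto P (Supp A)
          \<and> pinv A *v vectorization R = P *v vectorization M))"
proof -
  let ?Rm = "Rmap \<rho> :: complex^('a \<times> 'b)^('a \<times> 'b) \<Rightarrow> _"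
  let ?f = "\<lambda>t::real. mexp (- t *\<^sub>R \<rho>t) ** R ** mexp (- t *\<^sub>R \<rho>t)"
  have psd: "psd \<rho>"
    using \<open>density_matrix \<rho>\<close> by (simp add: density_matrix_def)
  have Rm: "?Rm X = (1/2) *\<^sub>R (\<rho>t ** X + X ** \<rho>t)" for X
    using \<open>\<rho>t = \<rho> \<otimes> mat 1\<close> by (simp add: Rmap_def)
  have vec_Rm: "vectorization (?Rm X) = A *v vectorization X" for X
    unfolding Rm \<open>A = _\<close> by (rule vectorization_anticommutator)
  then have vec_R: "vectorization R = A *v vectorization M"
    using \<open>R = Rmap \<rho> M\<close> by simp
  \<comment> \<open>Vectorization is a bijection that respects 0, so every vector killed by
    \<open>A\<close> comes from a matrix killed by the anticommutator.\<close>
  have ker_A: "(\<exists>w. w \<noteq> 0 \<and> A *v w = 0) \<longleftrightarrow> (\<exists>X. X \<noteq> 0 \<and> ?Rm X = 0)"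
  proof -
    have vec_0: "vectorization Y = 0 \<longleftrightarrow> Y = 0" for Y :: "complex^('a \<times> 'b)^('a \<times> 'b)"
      by (auto simp: vectorization_def vec_eq_iff)
    have "(\<exists>w. w \<noteq> 0 \<and> A *v w = 0) \<longleftrightarrow> (\<exists>w\<in>range vectorization. w \<noteq> 0 \<and> A *v w = 0)"
      by (simp add: bij_is_surj[OF bij_vectorization])
    also have "\<dots> \<longleftrightarrow> (\<exists>X. vectorization X \<noteq> 0 \<and> A *v vectorization X = 0)"
      by blast
    finally show ?thesis
      by (simp only: vec_Rm [symmetric] vec_0)
  qed
  have bij_iff: "bij ?Rm \<longleftrightarrow> invertible A"
  proof -
    have "vectorization \<circ> ?Rm = (*v) A \<circ> vectorization"
      using vec_Rm by (simp add: fun_eq_iff)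
    moreover have "bij (vectorization \<circ> ?Rm) \<longleftrightarrow> bij ?Rm"
      by (rule bij_betw_comp_iff2[OF bij_vectorization, symmetric]) simp
    moreover have "bij ((*v) A \<circ> vectorization) \<longleftrightarrow> bij ((*v) A)"
      by (rule bij_betw_comp_iff[OF bij_vectorization, symmetric])
    ultimately show ?thesis
      by (simp only: invertible_eq_bij)
  qed
  have inv_iff: "invertible A \<longleftrightarrow> \<not> (\<exists>X. X \<noteq> 0 \<and> ?Rm X = 0)"
    unfolding ker_A [symmetric] invertible_left_inverse matrix_left_invertible_ker by blast

  have full: "invertible A \<and> bij ?Rm \<and> vectorization M = matrix_inv A *v vectorization R \<and>
      ?f absolutely_integrable_on {0..} \<and> M = 2 *\<^sub>R integral {0..} ?f"
    if "rank \<rho> = CARD('a)"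
  proof -
    have "0 < inner w (\<rho> *v w)" if "w \<noteq> 0" for w
    proof -
      have "\<rho> *v w \<noteq> 0"
        using rank_less_card_iff_ker[of \<rho>] \<open>rank \<rho> = CARD('a)\<close> \<open>w \<noteq> 0\<close> by auto
      then show ?thesis
        using psd_inner_nonneg[OF psd, of w] psd_kernel[OF psd, of w] by (auto simp: less_le)
    qed
    then have "0 < inner v (\<rho>t *v v)" if "v \<noteq> 0" for v
      unfolding \<open>\<rho>t = \<rho> \<otimes> mat 1\<close> using that by (rule inner_kron_mat_1_pos)
    note lyapunov = lyapunov_integral[OF this]
    have Rm2: "\<rho>t ** X + X ** \<rho>t = 2 *\<^sub>R ?Rm X" for X
      by (simp add: Rm)
    \<comment> \<open>For such \<open>X\<close> the Lyapunov integrand vanishes identically, while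
      its integral is \<open>X\<close>.\<close>
    have "X = 0" if "?Rm X = 0" for X
    proof -
      have "((\<lambda>t. 0) has_integral X) {0..}"
        using lyapunov(2)[of X] unfolding Rm2 that by simp
      then show ?thesis by (metis has_integral_0 has_integral_unique)
    qed
    then have inv: "invertible A"
      unfolding inv_iff by blast
    then have "matrix_inv A ** A = mat 1"
      unfolding invertible_def matrix_inv_def by (rule someI2_ex) blast
    then have "vectorization M = matrix_inv A *v vectorization R"
      by (simp add: vec_R matrix_vector_mul_assoc)
    moreover
    \<comment> \<open>The Lyapunov integrand contains the full anticommutator, which is
      \<open>2 *\<^sub>R R\<close>; halving it gives the integrand of the claim, with integral half
      of \<open>M\<close>.\<close>
    have half: "(1/2) *\<^sub>R (mexp (- t *\<^sub>R \<rho>t) ** (\<rho>t ** M + M ** \<rho>t) ** mexp (- t *\<^sub>R \<rho>t)) = ?f t" for t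
      by (simp add: Rm2 \<open>R = Rmap \<rho> M\<close> bounded_bilinear.scaleR_left[OF bounded_bilinear_matrix_mult]
          bounded_bilinear.scaleR_right[OF bounded_bilinear_matrix_mult])
    have "?f absolutely_integrable_on {0..}"
      using absolutely_integrable_scaleR_left[OF lyapunov(1)[of M], of "1/2"] unfolding half .
    moreover have "(?f has_integral (1/2) *\<^sub>R M) {0..}"
      using has_integral_cmul[OF lyapunov(2)[of M], of "1/2"] unfolding half .
    then have "M = 2 *\<^sub>R integral {0..} ?f"
      by (simp add: integral_unique)
    ultimately show ?thesis
      using inv bij_iff by blast
  qed

  have deficient: "rank A < CARD(('a \<times> 'b) \<times> ('a \<times> 'b)) \<and> \<not> bij ?Rm" if lt: "rank \<rho> < CARD('a)"
  proof -
    obtain u where u: "u \<noteq> 0" "\<rho> *v u = 0"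
      using lt unfolding rank_less_card_iff_ker by blast
    \<comment> \<open>This is \<open>u\<close> tensored with the all-ones vector, a nonzero kernel
      vector of the extended operator.\<close>
    define v :: "complex^('a \<times> 'b)" where "v = (\<chi> p. u $ fst p)"
    have "\<rho>t *v v = 0"
      using u(2) unfolding \<open>\<rho>t = \<rho> \<otimes> mat 1\<close>
      by (simp add: v_def kron_def mat_def vec_eq_iff matrix_vector_mult_def sum_UNIV_prod
          if_distrib if_distribR cong: if_cong)
    moreover have "dagger \<rho>t = \<rho>t"
      using psd_hermitian[OF psd] unfolding \<open>\<rho>t = \<rho> \<otimes> mat 1\<close>
      by (simp add: dagger_def kron_def mat_def vec_eq_iff)
    moreover define Z where "Z = (\<chi> i j. v $ i * cnj (v $ j))"
    ultimately have "?Rm Z = 0"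
      using anticommutator_kernel[of \<rho>t v] by (simp add: Rm)
    \<comment> \<open>The diagonal entries of \<open>Z\<close> are the squared moduli of the entries
      of \<open>v\<close>.\<close>
    moreover have "Z \<noteq> 0"
      using u(1) by (auto simp: Z_def v_def vec_eq_iff)
    ultimately have *: "\<exists>X. X \<noteq> 0 \<and> ?Rm X = 0" by blast
    then have "rank A < CARD(('a \<times> 'b) \<times> ('a \<times> 'b))"
      unfolding rank_less_card_iff_ker ker_A .
    moreover have "\<not> bij ?Rm"
      using * by (simp add: bij_iff inv_iff)
    ultimately show ?thesis by blast
  qed

  have "pinv A *v vectorization R = (pinv A ** A) *v vectorization M"
    by (simp add: vec_R matrix_vector_mul_assoc)
  then show ?thesis
    unfolding Let_def using vec_R full deficient pinv_mult_orthogonal_projector[of A] by blast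
qed

end
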